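(* Let $G$ be a connected undirected graph on $N\ge 2$ nodes with positive link weights, let $\mathcal{S}$ be its simplex in $\mathbb{R}^{N-1}$, and let $\xi$ be the (weighted) number of spanning trees of $G$. Then the volume $\vert\mathcal{E}_{\mathcal{S}}\vert$ of (the region enclosed by) the Steiner circumscribed ellipsoid $\mathcal{E}_{\mathcal{S}}$ of $\mathcal{S}$ is $$\vert\mathcal{E}_{\mathcal{S}}\vert=\left(\frac{(N-1)\pi}{N}\right)^{\frac{N-1}{2}}\frac{\sqrt{N\xi}}{\Gamma\left(\frac N2+\frac12\right)}.$$
   Context: The graph $G$ has node set $\mathcal{N}=\{1,\dots,N\}$, link set $\mathcal{L}$ (links join distinct nodes) and weights $w_{ij}=w_{ji}>0$ for $(i,j)\in\mathcal{L}$ (all equal to $1$ in the unweighted case). The Laplacian $Q$ is the $N\times N$ symmetric matrix with $(Q)_{ii}=d_i$, the sum of the weights of links incident to $i$, $(Q)_{ij}=-w_{ij}$ if $(i,j)\in\mathcal{L}$, and $(Q)_{ij}=0$ otherwise. Since $G$ is connected, $Q$ has eigenvalues $\mu_1\ge\dots\ge\mu_{N-1}>\mu_N=0$ with orthonormal eigenvectors $z_1,\dots,z_N$. The simplex $\mathcal{S}$ of $G$ is the convex hull of the vertices $s_1,\dots,s_N\in\mathbb{R}^{N-1}$ with $(s_i)_k=(z_k)_i\sqrt{\mu_k}$, $k=1,\dots,N-1$. Let $S^{\dagger}$ be the $(N-1)\times N$ matrix whose $i$-th column $s_i^{+}$ has entries $(s_i^{+})_k=(z_k)_i/\sqrt{\mu_k}$.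 The Steiner circumscribed ellipsoid of $\mathcal{S}$ (the unique ellipsoid of minimal volume passing through all vertices of $\mathcal{S}$) is $$\mathcal{E}_{\mathcal{S}}=\left\{p\in\mathbb{R}^{N-1} : p^TS^{\dagger}S^{\dagger T}p=\tfrac{N-1}{N}\right\},$$ and its volume is the $(N-1)$-dimensional Lebesgue measure of the region it bounds, obtained by replacing $=$ with $\le$. $\xi$ is the number of spanning trees of $G$ in the unweighted case; in the weighted case it is the sum over all spanning trees of the product of the link weights of the tree. It satisfies $\xi=\frac1N\prod_{k=1}^{N-1}\mu_k$. $\Gamma$ is the Gamma function. *)

theory Defs
  imports "HOL-Analysis.Analysis"
begin

(* The nodes are the elements of a finite type 'n.  A link is a two-element set of nodes, so the
   weight w_ij = w_ji of the link between i and j is w {i, j}, symmetric by construction. *)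

definition weighted_graph :: "'n set set \<Rightarrow> ('n set \<Rightarrow> real) \<Rightarrow> bool" where
  "weighted_graph L w \<longleftrightarrow> (\<forall>e\<in>L. card e = 2 \<and> w e > 0)"

(* Quantifying over the whole type makes a connected set of links automatically spanning. *)
definition connected_links :: "'n set set \<Rightarrow> bool" where
  "connected_links L \<longleftrightarrow> (\<forall>u v. (u, v) \<in> {(i, j). {i, j} \<in> L}\<^sup>*)"

definition acyclic_links :: "'n set set \<Rightarrow> bool" where
  "acyclic_links L \<longleftrightarrow>
     \<not> (\<exists>c. length c \<ge> 3 \<and> distinct c \<and>
            (\<forall>i<length c. {c ! i, c ! (Suc i mod length c)} \<in> L))"

definition spanning_trees :: "'n set set \<Rightarrow> 'n set set set" where
  "spanning_trees L = {T. T \<subseteq> L \<and> connected_links T \<and> acyclic_links T}"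

(* The weighted number xi of spanning trees; it is their number if all weights are 1. *)
definition spanning_tree_weight :: "'n set set \<Rightarrow> ('n set \<Rightarrow> real) \<Rightarrow> real" where
  "spanning_tree_weight L w = (\<Sum>T\<in>spanning_trees L. \<Prod>e\<in>T. w e)"

definition laplacian :: "'n::finite set set \<Rightarrow> ('n set \<Rightarrow> real) \<Rightarrow> real^'n^'n" where
  "laplacian L w =
     (\<chi> i j. if i = j then (\<Sum>e\<in>{e\<in>L. i \<in> e}. w e)
            else if {i, j} \<in> L then - w {i, j} else 0)"

(* The linearly ordered type 'm, of cardinality N - 1, plays the role of the indices 1, ..., N - 1:
   \<mu> and z are the positive eigenvalues in non-increasing order and their eigenvectors.
   zN is the eigenvector z_N of the remaining eigenvalue 0. *)
definition laplacian_eigensystem ::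
  "'n::finite set set \<Rightarrow> ('n set \<Rightarrow> real) \<Rightarrow>
   ('m::{finite,linorder} \<Rightarrow> real) \<Rightarrow> ('m \<Rightarrow> real^'n) \<Rightarrow> real^'n \<Rightarrow> bool" where
  "laplacian_eigensystem L w \<mu> z zN \<longleftrightarrow>
     (\<forall>k. laplacian L w *v z k = \<mu> k *\<^sub>R z k) \<and> laplacian L w *v zN = 0 \<and>
     antimono \<mu> \<and> (\<forall>k. \<mu> k > 0) \<and>
     (\<forall>k l. z k \<bullet> z l = (if k = l then 1 else 0)) \<and>
     (\<forall>k. z k \<bullet> zN = 0) \<and> zN \<bullet> zN = 1"

definition simplex_vertex :: "('m \<Rightarrow> real) \<Rightarrow> ('m \<Rightarrow> real^'n) \<Rightarrow> 'n \<Rightarrow> real^'m" where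
  "simplex_vertex \<mu> z i = (\<chi> k. z k $ i * sqrt (\<mu> k))"

definition graph_simplex :: "('m::finite \<Rightarrow> real) \<Rightarrow> ('m \<Rightarrow> real^'n) \<Rightarrow> (real^'m) set" where
  "graph_simplex \<mu> z = convex hull (range (simplex_vertex \<mu> z))"

(* The matrix whose columns are s_1^+, ..., s_N^+. *)
definition S_dagger :: "('m \<Rightarrow> real) \<Rightarrow> ('m \<Rightarrow> real^'n) \<Rightarrow> real^'n^'m" where
  "S_dagger \<mu> z = (\<chi> k i. z k $ i / sqrt (\<mu> k))"

(* The Steiner circumscribed ellipsoid of graph_simplex \<mu> z (a hypersurface). *)
definition steiner_ellipsoid :: "('m::finite \<Rightarrow> real) \<Rightarrow> ('m \<Rightarrow> real^'n::finite) \<Rightarrow> (real^'m) set" where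
  "steiner_ellipsoid \<mu> z =
     {p. p \<bullet> ((S_dagger \<mu> z ** transpose (S_dagger \<mu> z)) *v p)
         = (real CARD('n) - 1) / real CARD('n)}"

(* The region enclosed by steiner_ellipsoid \<mu> z. *)
definition steiner_region :: "('m::finite \<Rightarrow> real) \<Rightarrow> ('m \<Rightarrow> real^'n::finite) \<Rightarrow> (real^'m) set" where
  "steiner_region \<mu> z =
     {p. p \<bullet> ((S_dagger \<mu> z ** transpose (S_dagger \<mu> z)) *v p)
         \<le> (real CARD('n) - 1) / real CARD('n)}"

end

theory Submission
  imports Defs
begin

text \<open>
  The matrix \<^term>\<open>S_dagger \<mu> z ** transpose (S_dagger \<mu> z)\<close> is diagonal with entries $1/\mu_k$, so the
  enclosed region is a ball of radius $\sqrt{(N-1)/N}$ stretched by $\sqrt{\mu_k}$ along the axes; its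
  volume is $\sqrt{\prod_k \mu_k}$ times that of the ball. It remains to show $\prod_k \mu_k = N \xi$.

  The product of the $\mu_k$ is the determinant of $Q + z_N z_N^T$, where $z_N$ is a constant vector, and
  this matrix is a sum of rank-one matrices, one for each link and one for $z_N$. The Cauchy--Binet
  formula writes its determinant as a sum over sets of $N$ of these vectors. Only sets consisting of
  $z_N$ and the links of a spanning tree contribute: otherwise some nonzero vector is orthogonal to
  all of them. For a spanning tree, orienting the links towards a root makes the determinant
  triangular with respect to the depth of the nodes.
\<close>

section \<open>Determinants of sums of rank-one matrices\<close>

text \<open>Multilinearity in all rows at once: \<open>f\<close> selects one summand per row, since
  the product over \<open>i\<close> in each Leibniz term expands into a sum over choice
  functions.\<close>

lemma det_sum_rows:
  fixes a :: "'n::finite \<Rightarrow> 's \<Rightarrow> 'a::comm_ring_1^'n"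
  assumes "finite S"
  shows "det (\<chi> i. \<Sum>s\<in>S. a i s) = (\<Sum>f\<in>UNIV \<rightarrow>\<^sub>E S. det (\<chi> i. a i (f i)))"
proof -
  have "det (\<chi> i. \<Sum>s\<in>S. a i s) =
    (\<Sum>p | p permutes UNIV. \<Sum>f\<in>UNIV \<rightarrow>\<^sub>E S. of_int (sign p) * (\<Prod>i\<in>UNIV. a i (f i) $ p i))"
    unfolding det_def using assms by (simp add: sum_component prod_sum_PiE sum_distrib_left)
  also have "\<dots> = (\<Sum>f\<in>UNIV \<rightarrow>\<^sub>E S. det (\<chi> i. a i (f i)))"
    unfolding det_def by (subst sum.swap) simp
  finally show ?thesis .
qed

text \<open>Cauchy--Binet for a Gram-type matrix, over an index set without an order. Row
  \<open>i\<close> is the sum over \<open>s\<close> of multiples of the vectors \<open>a s\<close>,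
  so multilinearity gives a sum over choice functions, of which the non-injective ones repeat a row.
  \<open>g T\<close> is any enumeration of \<open>T\<close>: another one changes the determinant
  only by a sign, which the square removes.\<close>

lemma det_sum_rank_one:
  fixes a :: "'s \<Rightarrow> 'a::comm_ring_1^'n::finite" and g :: "'s set \<Rightarrow> 'n \<Rightarrow> 's"
  defines "\<T> S \<equiv> {T. T \<subseteq> S \<and> card T = CARD('n)}"
  assumes S: "finite S"
    and g: "\<And>T. T \<in> \<T> S \<Longrightarrow> bij_betw (g T) UNIV T"
  shows "det (\<chi> i j. \<Sum>s\<in>S. a s $ i * a s $ j) = (\<Sum>T\<in>\<T> S. (det (\<chi> i. a (g T i)))\<^sup>2)"
proof -
  define h where "h f = (\<Prod>i\<in>UNIV. a (f i) $ i) * det (\<chi> i. a (f i))" for f :: "'n \<Rightarrow> 's"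
  let ?P = "{p. p permutes (UNIV :: 'n set)}"
  have fin: "finite (\<T> S)"
    unfolding \<T>_def using S by simp
  have rT: "range (g T) = T" and iT: "inj (g T)" if "T \<in> \<T> S" for T
    using g[OF that] by (auto simp: bij_betw_def)
  have "det (\<chi> i j. \<Sum>s\<in>S. a s $ i * a s $ j) = det (\<chi> i. \<Sum>s\<in>S. a s $ i *s a s)"
    by (rule arg_cong[of _ _ det]) (simp add: vec_eq_iff sum_component)
  also have "\<dots> = (\<Sum>f\<in>UNIV \<rightarrow>\<^sub>E S. h f)"
    using S by (simp add: det_sum_rows det_rows_mul h_def)
  also have "\<dots> = (\<Sum>f | f \<in> UNIV \<rightarrow>\<^sub>E S \<and> inj f. h f)"
  proof (rule sum.mono_neutral_right)
    show "finite (UNIV \<rightarrow>\<^sub>E S :: ('n \<Rightarrow> 's) set)"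
      using S by (intro finite_PiE) auto
    show "\<forall>f\<in>(UNIV \<rightarrow>\<^sub>E S) - {f \<in> UNIV \<rightarrow>\<^sub>E S. inj f}. h f = 0"
    proof
      fix f assume "f \<in> (UNIV \<rightarrow>\<^sub>E S) - {f \<in> UNIV \<rightarrow>\<^sub>E S. inj (f :: 'n \<Rightarrow> 's)}"
      then obtain i j where "i \<noteq> j" "f i = f j"
        by (auto simp: inj_on_def)
      then have "det (\<chi> i. a (f i)) = 0"
        by (intro det_identical_rows[of i j]) (auto simp: row_def)
      then show "h f = 0"
        by (simp add: h_def)
    qed
  qed auto
  \<comment> \<open>An injective \<open>f\<close> amounts to its range \<open>T\<close> together
    with the permutation \<open>p\<close> for which \<open>f = g T \<circ> p\<close>.\<close>
  also have "\<dots> = (\<Sum>(T, p)\<in>\<T> S \<times> ?P. h (g T \<circ> p))"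
  proof (rule sum.reindex_bij_witness[where i = "\<lambda>(T, p). g T \<circ> p"
        and j = "\<lambda>f. (range f, inv (g (range f)) \<circ> f)"])
    fix f :: "'n \<Rightarrow> 's" assume "f \<in> {f \<in> UNIV \<rightarrow>\<^sub>E S. inj f}"
    then have f: "f \<in> UNIV \<rightarrow>\<^sub>E S" "inj f"
      by auto
    then have T: "range f \<in> \<T> S"
      by (auto simp: \<T>_def card_image)
    have *: "g (range f) (inv (g (range f)) (f x)) = f x" for x
      using rT[OF T] by (metis f_inv_into_f rangeI)
    have "inj (inv (g (range f)) \<circ> f)"
      using * f(2) by (auto simp: inj_on_def) metis
    then have "(inv (g (range f)) \<circ> f) permutes UNIV"
      by (intro bij_imp_permutes) (auto simp: bij_def dest: finite_UNIV_inj_surj[rotated])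
    then show "(range f, inv (g (range f)) \<circ> f) \<in> \<T> S \<times> ?P"
      using T by auto
    show "(case (range f, inv (g (range f)) \<circ> f) of (T, p) \<Rightarrow> g T \<circ> p) = f"
      using * by auto
    show "(case (range f, inv (g (range f)) \<circ> f) of (T, p) \<Rightarrow> h (g T \<circ> p)) = h f"
      using * by (simp add: comp_def)
  next
    fix x assume "x \<in> \<T> S \<times> ?P"
    then obtain T p where x: "x = (T, p)" and T: "T \<in> \<T> S" and p: "p permutes (UNIV :: 'n set)"
      by auto
    have range: "range (g T \<circ> p) = T"
      using rT[OF T] permutes_surj[OF p] by (metis image_comp)
    then show "(range (case x of (T, p) \<Rightarrow> g T \<circ> p),
        inv (g (range (case x of (T, p) \<Rightarrow> g T \<circ> p))) \<circ> (case x of (T, p) \<Rightarrow> g T \<circ> p)) = x"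
      using iT[OF T] by (auto simp: x fun_eq_iff)
    have "inj (g T \<circ> p)"
      using iT[OF T] permutes_inj[OF p] by (rule inj_compose)
    then show "(case x of (T, p) \<Rightarrow> g T \<circ> p) \<in> {f \<in> UNIV \<rightarrow>\<^sub>E S. inj f}"
      using range T by (auto simp: x \<T>_def)
  qed
  also have "\<dots> = (\<Sum>T\<in>\<T> S. \<Sum>p\<in>?P. h (g T \<circ> p))"
    by (rule sum.cartesian_product[symmetric])
  also have "\<dots> = (\<Sum>T\<in>\<T> S. (det (\<chi> i. a (g T i)))\<^sup>2)"
  proof (rule sum.cong[OF refl])
    fix T
    let ?A = "\<chi> i. a (g T i)"
    \<comment> \<open>Permuting the rows pulls out the factor \<open>sign p * det ?A\<close>; what
      remains of the sum over \<open>p\<close> is the Leibniz formula for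
      \<open>transpose ?A\<close>.\<close>
    have "(\<Sum>p\<in>?P. h (g T \<circ> p)) = (\<Sum>p\<in>?P. of_int (sign p) * (\<Prod>i\<in>UNIV. transpose ?A $ i $ p i) * det ?A)"
    proof (rule sum.cong[OF refl])
      fix p assume "p \<in> ?P"
      then have "det (\<chi> i. ?A $ p i) = of_int (sign p) * det ?A"
        by (intro det_permute_rows) auto
      then show "h (g T \<circ> p) = of_int (sign p) * (\<Prod>i\<in>UNIV. transpose ?A $ i $ p i) * det ?A"
        by (simp add: h_def transpose_def mult_ac)
    qed
    also have "\<dots> = det (transpose ?A) * det ?A"
      unfolding det_def[of "transpose ?A"] by (rule sum_distrib_right[symmetric])
    finally show "(\<Sum>p\<in>?P. h (g T \<circ> p)) = (det ?A)\<^sup>2"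
      by (simp only: det_transpose power2_eq_square)
  qed
  finally show ?thesis .
qed

section \<open>Spanning trees\<close>

text \<open>Breadth-first search: \<open>d v\<close> is the distance from \<open>v\<close> to
  \<open>r\<close>, and \<open>p v\<close> is the next node on a shortest walk from \<open>v\<close>
  to \<open>r\<close>.\<close>

lemma connected_links_parents:
  fixes r :: 'n
  assumes "connected_links T" and "\<And>e. e \<in> T \<Longrightarrow> card e = 2"
  obtains p :: "'n \<Rightarrow> 'n" and d :: "'n \<Rightarrow> nat"
  where "\<And>v. v \<noteq> r \<Longrightarrow> {v, p v} \<in> T" and "\<And>v. v \<noteq> r \<Longrightarrow> d (p v) < d v"
proof -
  define R where "R = {(i, j). {i, j} \<in> T}"
  define d where "d v = (LEAST n. (v, r) \<in> R ^^ n)" for v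
  have d: "(v, r) \<in> R ^^ d v" for v
  proof -
    have "(v, r) \<in> R\<^sup>*"
      using assms(1) by (simp add: connected_links_def R_def)
    then obtain n where "(v, r) \<in> R ^^ n"
      by (auto simp: rtrancl_power)
    then show ?thesis
      unfolding d_def by (rule LeastI)
  qed
  have "\<exists>u. {v, u} \<in> T \<and> d u < d v" if "v \<noteq> r" for v
  proof (cases "d v")
    case 0
    then show ?thesis using d[of v] that by simp
  next
    case (Suc n)
    with d[of v] obtain u where "(v, u) \<in> R" "(u, r) \<in> R ^^ n"
      by (metis relpow_Suc_E2)
    then show ?thesis
      using Suc by (auto simp: R_def d_def[of u] intro!: exI[of _ u] le_imp_less_Suc Least_le)
  qed
  then show ?thesis
    using that by metis
qed

section \<open>Trees given by a parent map\<close>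

text \<open>A rooted tree is encoded by the pointer from each node other than \<open>r\<close> to
  its parent. The strict descent of \<open>d\<close> excludes cycles and supports induction towards
  the root.\<close>

locale parents =
  fixes r :: "'n::finite" and p :: "'n \<Rightarrow> 'n" and d :: "'n \<Rightarrow> nat"
  assumes depth: "v \<noteq> r \<Longrightarrow> d (p v) < d v"
begin

text \<open>If two distinct nodes had the same parent link, each would be the parent of the other,
  and the depth would drop in both directions.\<close>

lemma inj_parent_link: "inj_on (\<lambda>v. {v, p v}) (- {r})"
proof (rule inj_onI)
  fix u v assume "u \<in> - {r}" "v \<in> - {r}" "{u, p u} = {v, p v}"
  then show "u = v"
    using depth[of u] depth[of v] by (auto simp: doubleton_eq_iff)
qed

definition tree :: "'n set set" where
  "tree = (\<lambda>v. {v, p v}) ` (- {r})"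

lemma card_tree: "card tree = CARD('n) - 1"
  unfolding tree_def by (simp add: card_image inj_parent_link) (simp add: Compl_eq_Diff_UNIV)

lemma reaches_root: "(v, r) \<in> {(i, j). {i, j} \<in> tree}\<^sup>*"
proof (induction "d v" arbitrary: v rule: less_induct)
  case less
  show ?case
  proof (cases "v = r")
    case False
    then have "(v, p v) \<in> {(i, j). {i, j} \<in> tree}"
      by (auto simp: tree_def)
    then show ?thesis
      using less[OF depth[OF False]] by (rule converse_rtrancl_into_rtrancl)
  qed simp
qed

lemma connected_tree: "connected_links tree"
  unfolding connected_links_def
proof (intro allI)
  fix u v
  have "sym {(i, j). {i, j} \<in> tree}"
    by (auto simp: sym_def insert_commute)
  then have "(r, v) \<in> {(i, j). {i, j} \<in> tree}\<^sup>*"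
    using reaches_root[of v] by (metis sym_rtrancl symD)
  then show "(u, v) \<in> {(i, j). {i, j} \<in> tree}\<^sup>*"
    using reaches_root[of u] by (rule rtrancl_trans[rotated])
qed

text \<open>Both neighbours on a cycle of a deepest node of the cycle would be its parent.\<close>

lemma acyclic_tree: "acyclic_links tree"
  unfolding acyclic_links_def
proof (rule notI, elim exE conjE)
  fix c :: "'n list"
  assume len: "length c \<ge> 3" and dist: "distinct c"
    and c: "\<forall>i<length c. {c ! i, c ! (Suc i mod length c)} \<in> tree"
  let ?D = "(\<lambda>i. d (c ! i)) ` {..<length c}"
  have "?D \<noteq> {}"
    using len by (auto simp: lessThan_empty_iff)
  then have "Max ?D \<in> ?D"
    by (intro Max_in) simp_all
  then obtain k where k1: "k < length c" "d (c ! k) = Max ?D"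
    by auto
  have k: "k < length c" "\<And>i. i < length c \<Longrightarrow> d (c ! i) \<le> d (c ! k)"
    using k1 by simp_all
  have parent: "u = p v" if "{v, u} \<in> tree" "d u \<le> d v" for u v
    using that depth by (force simp: tree_def doubleton_eq_iff)
  \<comment> \<open>The cyclic predecessor of \<open>k\<close>, so that the link with index
    \<open>i\<close> joins \<open>c ! i\<close> and \<open>c ! k\<close>; \<open>j\<close> is the
    cyclic successor.\<close>
  define i where "i = (if k = 0 then length c - 1 else k - 1)"
  define j where "j = Suc k mod length c"
  have i: "i < length c" "Suc i mod length c = k"
    using k(1) len by (auto simp: i_def)
  have j: "j < length c"
    unfolding j_def by (rule mod_less_divisor) (use len in linarith)
  have "c ! i = p (c ! k)"
    using c[rule_format, OF i(1)] i k(2)[OF i(1)] by (intro parent) (simp_all add: insert_commute)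
  moreover have "c ! j = p (c ! k)"
    using c[rule_format, OF k(1)] k(2)[OF j] by (intro parent) (simp_all add: j_def)
  ultimately have "c ! i = c ! j"
    by simp
  then have "i = j"
    using dist i(1) j by (simp add: nth_eq_iff_index_eq)
  \<comment> \<open>Predecessor and successor of a position differ on a cycle of length at least
    3.\<close>
  then show False
    using k(1) len by (auto simp: i_def j_def mod_Suc split: if_splits)
qed

end

section \<open>Minimality of connected link sets and the number of links of a tree\<close>

text \<open>The path is built step by step; if the next node already lies on it, the path is cut off
  at that node instead of being extended.\<close>

lemma rtrancl_distinct_path:
  assumes "(u, v) \<in> R\<^sup>*"
  obtains c where "c \<noteq> []" "hd c = u" "last c = v" "distinct c"
    and "\<And>i. Suc i < length c \<Longrightarrow> (c ! i, c ! Suc i) \<in> R"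
proof -
  from assms have "\<exists>c. c \<noteq> [] \<and> hd c = u \<and> last c = v \<and> distinct c \<and>
    (\<forall>i. Suc i < length c \<longrightarrow> (c ! i, c ! Suc i) \<in> R)"
  proof (induction rule: rtrancl_induct)
    case base
    show ?case by (rule exI[of _ "[u]"]) simp
  next
    case (step y z)
    then obtain c where c: "c \<noteq> []" "hd c = u" "last c = y" "distinct c"
      "\<And>i. Suc i < length c \<Longrightarrow> (c ! i, c ! Suc i) \<in> R" by blast
    show ?case
    proof (cases "z \<in> set c")
      case True
      then obtain k where k: "k < length c" "c ! k = z"
        by (auto simp: in_set_conv_nth)
      have "last (take (Suc k) c) = z"
        using k by (simp add: take_Suc_conv_app_nth)
      then show ?thesis
        using c k(1) by (intro exI[of _ "take (Suc k) c"]) simp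
    next
      case False
      have "((c @ [z]) ! i, (c @ [z]) ! Suc i) \<in> R" if "Suc i < length (c @ [z])" for i
      proof (cases "Suc i < length c")
        case True
        then show ?thesis using c(5) by (simp add: nth_append)
      next
        case False
        then have "i = length c - 1" using that by simp
        then show ?thesis
          using c(1,3) step(2) by (simp add: nth_append last_conv_nth)
      qed
      then show ?thesis
        using c False by (intro exI[of _ "c @ [z]"]) auto
    qed
  qed
  then show ?thesis using that by blast
qed

text \<open>A link \<open>e = {a, b}\<close> of \<open>T\<close> outside \<open>U\<close> would
  close a simple path from \<open>a\<close> to \<open>b\<close> in \<open>U\<close> to a cycle in
  \<open>T\<close>. The path has at least three nodes, because \<open>a \<noteq> b\<close> and a
  path of two nodes would put \<open>e\<close> into \<open>U\<close>.\<close>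

lemma acyclic_links_subset_eq:
  assumes "acyclic_links T" and "\<And>e. e \<in> T \<Longrightarrow> card e = 2"
    and "U \<subseteq> T" and "connected_links U"
  shows "U = T"
proof (rule ccontr)
  assume "U \<noteq> T"
  then obtain e where e: "e \<in> T" "e \<notin> U"
    using assms(3) by blast
  then obtain a b where ab: "e = {a, b}" "a \<noteq> b"
    using assms(2) by (metis card_2_iff)
  obtain c where c: "c \<noteq> []" "hd c = a" "last c = b" "distinct c"
    "\<And>i. Suc i < length c \<Longrightarrow> (c ! i, c ! Suc i) \<in> {(i, j). {i, j} \<in> U}"
    using assms(4) rtrancl_distinct_path[of a b "{(i, j). {i, j} \<in> U}"]
    unfolding connected_links_def by metis
  have "length c \<noteq> 1"
    using c(2,3) ab(2) by (cases c) auto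
  moreover have "length c \<noteq> 2"
  proof
    assume "length c = 2"
    then show False
      using c(2,3) c(5)[of 0] e ab(1) c(1) by (simp add: hd_conv_nth last_conv_nth)
  qed
  moreover have "length c \<noteq> 0"
    using c(1) by simp
  ultimately have "length c \<ge> 3"
    by linarith
  moreover have "{c ! i, c ! (Suc i mod length c)} \<in> T" if "i < length c" for i
  proof (cases "Suc i < length c")
    case True
    then show ?thesis using c(5)[OF True] assms(3) by auto
  next
    \<comment> \<open>At the last position the index wraps around to 0, and the closing link is
      \<open>e\<close>.\<close>
    case False
    then have "Suc i = length c" using that by simp
    then show ?thesis
      using c(1-3) e(1) ab(1) by (simp add: hd_conv_nth last_conv_nth insert_commute flip: \<open>Suc i = length c\<close>)
  qed
  ultimately show False
    using assms(1) c(4) unfolding acyclic_links_def by blast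
qed

text \<open>The parent links form a connected acyclic subset of \<open>T\<close> with one link fewer
  than there are nodes; both sides are equivalent to \<open>T\<close> being equal to it.\<close>

lemma connected_acyclic_iff_card:
  fixes T :: "'n::finite set set"
  assumes "connected_links T" and "\<And>e. e \<in> T \<Longrightarrow> card e = 2"
  shows "acyclic_links T \<longleftrightarrow> card T = CARD('n) - 1"
proof -
  \<comment> \<open>\<open>undefined\<close> serves as an arbitrary root.\<close>
  obtain p d where pd: "\<And>v. v \<noteq> undefined \<Longrightarrow> {v, p v} \<in> T"
    "\<And>v. v \<noteq> undefined \<Longrightarrow> d (p v) < (d v :: nat)"
    using connected_links_parents[OF assms, of undefined] by blast
  interpret parents undefined p d
    by standard (rule pd(2))
  have sub: "tree \<subseteq> T"
    using pd(1) by (auto simp: tree_def)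
  show ?thesis
  proof
    assume "acyclic_links T"
    then have "tree = T"
      using assms(2) sub connected_tree by (rule acyclic_links_subset_eq)
    then show "card T = CARD('n) - 1"
      using card_tree by simp
  next
    assume "card T = CARD('n) - 1"
    then have "tree = T"
      using sub by (intro card_subset_eq) (simp_all add: card_tree)
    then show "acyclic_links T"
      using acyclic_tree by simp
  qed
qed

section \<open>Incidence vectors and the Laplacian\<close>

text \<open>The orientation of a link is arbitrary.\<close>

definition incidence :: "'n set \<Rightarrow> real^'n" where
  "incidence e = (SOME x. \<exists>a b. a \<noteq> b \<and> e = {a, b} \<and> x = axis a 1 - axis b 1)"

lemma incidence_cases:
  assumes "a \<noteq> b"
  shows "incidence {a, b} = axis a 1 - axis b 1 \<or> incidence {a, b} = axis b 1 - axis a 1"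
proof -
  have "\<exists>a' b'. a' \<noteq> b' \<and> {a, b} = {a', b'} \<and> incidence {a, b} = axis a' 1 - axis b' 1"
    unfolding incidence_def by (rule someI_ex) (use assms in blast)
  then show ?thesis
    by (auto simp: doubleton_eq_iff)
qed

text \<open>The sign left open by the orientation cancels in a product of two entries.\<close>

lemma incidence_times:
  assumes "card e = 2"
  shows "incidence e $ i * incidence e $ j =
    (if i = j then of_bool (i \<in> e) else - of_bool (e = {i, j}))"
proof -
  obtain a b where ab: "e = {a, b}" "a \<noteq> b"
    using assms by (metis card_2_iff)
  then show ?thesis
    using incidence_cases[OF ab(2)] by (auto simp: axis_def doubleton_eq_iff)
qed

lemma inner_incidence:
  fixes x :: "real^'n::finite"
  assumes "a \<noteq> b"
  shows "incidence {a, b} \<bullet> x = 0 \<longleftrightarrow> x $ a = x $ b"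
  using incidence_cases[OF assms] by (auto simp: inner_diff_left inner_axis')

lemma inner_incidence_one:
  assumes "card e = 2"
  shows "incidence e \<bullet> (1 :: real^'n::finite) = 0"
proof -
  obtain a b where "e = {a, b}" "a \<noteq> b"
    using assms by (metis card_2_iff)
  then show ?thesis
    by (simp add: inner_incidence)
qed

text \<open>The decomposition of the Laplacian into rank-one matrices, one for each link: a link
  contributes its weight to the diagonal at both ends and its negative weight to the two entries
  joining them.\<close>

lemma laplacian_nth:
  assumes "weighted_graph L w"
  shows "laplacian L w $ i $ j = (\<Sum>e\<in>L. w e * (incidence e $ i * incidence e $ j))"
proof -
  have card: "card e = 2" if "e \<in> L" for e
    using assms that by (simp add: weighted_graph_def)
  show ?thesis
  proof (cases "i = j")
    case True
    have "(\<Sum>e\<in>L. w e * (incidence e $ i * incidence e $ j)) = (\<Sum>e\<in>L. if i \<in> e then w e else 0)"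
      by (intro sum.cong refl) (simp add: incidence_times card True)
    then show ?thesis
      using True by (simp add: laplacian_def sum.inter_filter)
  next
    case False
    have "(\<Sum>e\<in>L. w e * (incidence e $ i * incidence e $ j)) =
      (\<Sum>e\<in>L. if e = {i, j} then - w e else 0)"
      by (intro sum.cong refl) (simp add: incidence_times card False)
    then show ?thesis
      using False by (simp add: laplacian_def sum.delta)
  qed
qed

lemma laplacian_quadratic_form:
  assumes "weighted_graph L w"
  shows "x \<bullet> (laplacian L w *v x) = (\<Sum>e\<in>L. w e * (incidence e \<bullet> x)\<^sup>2)"
proof -
  have "x \<bullet> (laplacian L w *v x) =
    (\<Sum>i\<in>UNIV. \<Sum>j\<in>UNIV. \<Sum>e\<in>L. w e * ((incidence e $ i * x $ i) * (incidence e $ j * x $ j)))"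
    unfolding inner_vec_def matrix_vector_mult_def
    by (simp add: laplacian_nth[OF assms] sum_distrib_left sum_distrib_right mult_ac)
  also have "\<dots> = (\<Sum>e\<in>L. \<Sum>i\<in>UNIV. \<Sum>j\<in>UNIV. w e * ((incidence e $ i * x $ i) * (incidence e $ j * x $ j)))"
    by (simp add: sum.swap[where B = L])
  also have "\<dots> = (\<Sum>e\<in>L. w e * (incidence e \<bullet> x)\<^sup>2)"
    by (simp only: inner_vec_def inner_real_def power2_eq_square sum_product)
      (simp only: sum_distrib_left)
  finally show ?thesis .
qed

text \<open>The quadratic form vanishes at \<open>x\<close> and is a sum of nonnegative terms, so
  \<open>x\<close> agrees at the ends of every link, and connectedness carries the equality from
  \<open>i\<close> to \<open>j\<close>.\<close>

lemma laplacian_kernel: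
  assumes "weighted_graph L w" and "connected_links L" and "laplacian L w *v x = 0"
  shows "x $ i = x $ j"
proof -
  have nonneg: "w e * (incidence e \<bullet> x)\<^sup>2 \<ge> 0" if "e \<in> L" for e
    using assms(1) that by (simp add: weighted_graph_def less_imp_le)
  have "(\<Sum>e\<in>L. w e * (incidence e \<bullet> x)\<^sup>2) = 0"
    using laplacian_quadratic_form[OF assms(1), of x] assms(3) by simp
  then have *: "w e * (incidence e \<bullet> x)\<^sup>2 = 0" if "e \<in> L" for e
    using nonneg that by (subst (asm) sum_nonneg_eq_0_iff) auto
  have link: "x $ a = x $ b" if "{a, b} \<in> L" for a b
  proof (cases "a = b")
    case False
    then show ?thesis
      using *[OF that] assms(1) that by (auto simp: weighted_graph_def inner_incidence)
  qed simp
  have "(i, j) \<in> {(a, b). {a, b} \<in> L}\<^sup>*"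
    using assms(2) by (simp add: connected_links_def)
  then show ?thesis
    by (induction rule: rtrancl_induct) (auto dest: link)
qed

section \<open>Determinants from kernels and eigenvectors\<close>

lemma det_eq_0_if_orthogonal:
  fixes A :: "real^'n^'n"
  assumes "\<And>i. A $ i \<bullet> x = 0" and "x \<noteq> 0"
  shows "det A = 0"
proof (rule ccontr)
  assume "det A \<noteq> 0"
  then have "inj ((*v) A)"
    using det_nz_iff_inj[of "(*v) A"] by simp
  moreover have "A *v x = A *v 0"
    using assms(1) by (simp add: vec_eq_iff matrix_vector_mul_component)
  ultimately show False
    using assms(2) by (metis injD)
qed

text \<open>The matrix \<open>P\<close> with rows \<open>y i\<close> is orthogonal and diagonalises
  \<open>A\<close>: \<open>P ** (A ** transpose P)\<close> is diagonal with the entries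
  \<open>l i\<close>, and the two factors \<open>det P\<close> multiply to 1.\<close>

lemma det_eq_prod_eigenvalues:
  fixes A :: "real^'n^'n" and y :: "'n \<Rightarrow> real^'n"
  assumes eig: "\<And>i. A *v y i = l i *\<^sub>R y i"
    and orth: "\<And>i j. y i \<bullet> y j = (if i = j then 1 else 0)"
  shows "det A = (\<Prod>i\<in>UNIV. l i)"
proof -
  define P where "P = (\<chi> i. y i)"
  have "P ** transpose P = mat 1"
    by (simp add: vec_eq_iff matrix_matrix_mult_def transpose_def P_def mat_def
        orth[unfolded inner_vec_def, simplified])
  then have 1: "det P * det P = 1"
    by (metis det_I det_mul det_transpose)
  have "(P ** (A ** transpose P)) $ i $ j = y i \<bullet> (A *v y j)" for i j
    by (simp add: matrix_matrix_mult_def matrix_vector_mult_def inner_vec_def transpose_def P_def)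
  then have "(P ** (A ** transpose P)) $ i $ j = (if i = j then l j else 0)" for i j
    by (simp add: eig orth)
  then have "det (P ** (A ** transpose P)) = (\<Prod>i\<in>UNIV. l i)"
    by (subst det_diagonal) auto
  then show ?thesis
    using 1 by (simp add: det_mul) (metis mult.commute mult.left_commute mult_1)
qed

section \<open>The determinant of the oriented links of a tree\<close>

context parents
begin

lemma parent_neq: "v \<noteq> r \<Longrightarrow> p v \<noteq> v"
  using depth[of v] by auto

text \<open>A permutation that only moves nodes to their parents can only lower depths, hence is the identity.\<close>

lemma det_reduced_tree_matrix:
  "det (\<chi> v. if v = r then axis r 1 else axis v 1 - axis (p v) 1 :: real^'n^'n) = 1" (is "det ?A = 1")
proof -
  have entry: "?A $ v $ u = (if v = r then of_bool (u = r) else of_bool (u = v) - of_bool (u = p v))" for v u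
    by (auto simp: axis_def)
  have "(\<Prod>v\<in>UNIV. ?A $ v $ \<sigma> v) = 0" if \<sigma>: "\<sigma> permutes UNIV" "\<sigma> \<noteq> id" for \<sigma>
  proof (rule ccontr)
    assume "\<not> ?thesis"
    then have nz: "?A $ v $ \<sigma> v \<noteq> 0" for v
      by auto
    then have moves: "\<sigma> v = v \<or> v \<noteq> r \<and> \<sigma> v = p v" for v
      using nz[of v] unfolding entry by (cases "v = r"; cases "\<sigma> v = v"; cases "\<sigma> v = p v") simp_all
    then have le: "d (\<sigma> v) \<le> d v" for v
      using depth by (metis less_imp_le order_refl)
    \<comment> \<open>A permutation preserves the total depth, so none of the inequalities can be
      strict.\<close>
    have "(\<Sum>v\<in>UNIV. d (\<sigma> v)) = (\<Sum>v\<in>UNIV. d v)"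
      using sum.permute[OF \<sigma>(1), of d] by (simp add: comp_def)
    then have "d (\<sigma> v) = d v" for v
      using le by (rule sum_mono_inv) auto
    then have "\<sigma> v = v" for v
      using moves[of v] depth[of v] by (metis less_irrefl)
    then show False
      using \<sigma>(2) by auto
  qed
  then have "det ?A = (\<Sum>\<sigma> | \<sigma> permutes UNIV. if \<sigma> = id then of_int (sign \<sigma>) * (\<Prod>v\<in>UNIV. ?A $ v $ \<sigma> v) else 0)"
    unfolding det_def by (intro sum.cong) auto
  also have "\<dots> = (\<Prod>v\<in>UNIV. ?A $ v $ v)"
    by (simp add: sum.delta permutes_id sign_id)
  also have "\<dots> = 1"
    by (rule prod.neutral) (use parent_neq in \<open>fastforce simp: axis_def\<close>)
  finally show ?thesis .
qed

text \<open>The determinant is linear in the root row, and the all-ones row is the sum of all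
  \<open>axis v 1\<close>. Each of these contributes 1: adding link rows moves
  \<open>axis v 1\<close> along the parents to \<open>axis r 1\<close> without changing the
  determinant.\<close>

lemma det_tree_matrix:
  "det (\<chi> v. if v = r then 1 else axis v 1 - axis (p v) 1 :: real^'n^'n) = of_nat CARD('n)"
proof -
  define M where "M x = det (\<chi> v. if v = r then x else axis v 1 - axis (p v) 1 :: real^'n^'n)" for x
  have M_axis: "M (axis v 1) = 1" for v
  proof (induction "d v" arbitrary: v rule: less_induct)
    case less
    show ?case
    proof (cases "v = r")
      case True
      then show ?thesis by (simp add: M_def det_reduced_tree_matrix)
    next
      case False
      have "M (axis v 1) = M ((axis v 1 - axis (p v) 1) + axis (p v) 1)"
        by simp
      also have "\<dots> = M (axis v 1 - axis (p v) 1) + M (axis (p v) 1)"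
        unfolding M_def by (rule det_row_add)
      \<comment> \<open>The root row now coincides with row \<open>v\<close>.\<close>
      also have "M (axis v 1 - axis (p v) 1) = 0"
        unfolding M_def by (rule det_identical_rows[of v r]) (use False in \<open>auto simp: row_def\<close>)
      finally show ?thesis
        using less[OF depth[OF False]] by simp
    qed
  qed
  have "(1 :: real^'n) = (\<Sum>v\<in>UNIV. axis v 1)"
    by (simp add: vec_eq_iff sum_component axis_def sum.delta)
  then have "M 1 = M (\<Sum>v\<in>UNIV. axis v 1)"
    by simp
  also have "\<dots> = (\<Sum>v\<in>UNIV. M (axis v 1))"
    unfolding M_def by (rule det_linear_row_sum) simp
  also have "\<dots> = of_nat CARD('n)"
    by (simp add: M_axis)
  finally show ?thesis
    unfolding M_def .
qed

end

section \<open>The weighted matrix-tree theorem\<close>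

text \<open>The value of a nonzero Cauchy--Binet term. Assigning to each node its parent link, and
  \<open>None\<close> to the root, yields the tree matrix up to row factors; squaring removes the
  arbitrary orientations and the square roots.\<close>

lemma det_links_square:
  fixes U :: "'n::finite set set"
  assumes tree: "connected_links U" "acyclic_links U" and links: "\<And>e. e \<in> U \<Longrightarrow> card e = 2"
    and w: "\<And>e. e \<in> U \<Longrightarrow> w e \<ge> 0"
    and a: "a None = vec c" "\<And>e. a (Some e) = sqrt (w e) *\<^sub>R incidence e"
  obtains f :: "'n \<Rightarrow> 'n set option"
  where "bij_betw f UNIV (insert None (Some ` U))"
    and "(det (\<chi> v. a (f v)))\<^sup>2 = c\<^sup>2 * (real CARD('n))\<^sup>2 * (\<Prod>e\<in>U. w e)"
proof -
  fix r :: 'n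
  obtain p d where pd: "\<And>v. v \<noteq> r \<Longrightarrow> {v, p v} \<in> U" "\<And>v. v \<noteq> r \<Longrightarrow> d (p v) < (d v :: nat)"
    using connected_links_parents[OF tree(1) links, of r] by blast
  interpret parents r p d
    by standard (rule pd(2))
  have U: "tree = U"
    using tree(2) links
    by (rule acyclic_links_subset_eq) (use pd(1) connected_tree in \<open>auto simp: tree_def\<close>)
  define f where "f v = (if v = r then None else Some {v, p v})" for v
  have "inj f"
  proof (rule injI)
    fix u v assume "f u = f v"
    then show "u = v"
      using inj_onD[OF inj_parent_link, of u v] by (simp add: f_def split: if_splits)
  qed
  moreover have "range f = insert None (Some ` U)"
  proof -
    have "range f = insert (f r) (f ` (- {r}))"
      by auto
    also have "f ` (- {r}) = Some ` U"
      unfolding U[symmetric] tree_def image_image by (rule image_cong) (auto simp: f_def)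
    finally show ?thesis
      by (simp add: f_def)
  qed
  ultimately have bij: "bij_betw f UNIV (insert None (Some ` U))"
    by (simp add: bij_betw_def)
  \<comment> \<open>The factor between row \<open>v\<close> and the row of the tree matrix: the
    constant at the root, elsewhere the root of the weight with the sign of the chosen
    orientation.\<close>
  define k where "k v = (if v = r then c
    else sqrt (w {v, p v}) * (if incidence {v, p v} = axis v 1 - axis (p v) 1 then 1 else - 1))" for v
  let ?A = "(\<chi> v. if v = r then 1 else axis v 1 - axis (p v) 1) :: real^'n^'n"
  have "a (f v) = k v *s (?A $ v)" for v
  proof (cases "v = r")
    case True
    then show ?thesis
      by (simp add: f_def k_def a vec_eq_iff)
  next
    case False
    then show ?thesis
      using incidence_cases[OF parent_neq[OF False, symmetric]]
      by (auto simp: f_def k_def a vec_eq_iff right_diff_distrib)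
  qed
  then have "det (\<chi> v. a (f v)) = (\<Prod>v\<in>UNIV. k v) * det ?A"
    using det_rows_mul[of k "($) ?A"] by simp
  then have "(det (\<chi> v. a (f v)))\<^sup>2 = (\<Prod>v\<in>UNIV. (k v)\<^sup>2) * (real CARD('n))\<^sup>2"
    by (simp only: det_tree_matrix power_mult_distrib prod_power_distrib)
  also have "(\<Prod>v\<in>UNIV. (k v)\<^sup>2) = c\<^sup>2 * (\<Prod>v\<in>- {r}. (k v)\<^sup>2)"
    by (subst prod.remove[of _ r]) (simp_all add: k_def Compl_eq_Diff_UNIV)
  also have "(\<Prod>v\<in>- {r}. (k v)\<^sup>2) = (\<Prod>v\<in>- {r}. w {v, p v})"
    using w pd(1) by (intro prod.cong) (auto simp: k_def power_mult_distrib)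
  also have "\<dots> = (\<Prod>e\<in>U. w e)"
    unfolding U[symmetric] tree_def by (simp add: prod.reindex[OF inj_parent_link])
  finally show ?thesis
    using bij by (intro that) (simp_all add: mult_ac)
qed

text \<open>The indicator of the nodes reachable from some \<open>u\<close> is constant along every
  link of \<open>U\<close>. Subtracting its mean makes it orthogonal to \<open>1\<close>, and it
  stays nonconstant because some \<open>v\<close> is unreachable.\<close>

lemma separating_vector:
  fixes U :: "'n::finite set set"
  assumes "\<not> connected_links U" and links: "\<And>e. e \<in> U \<Longrightarrow> card e = 2"
  obtains x :: "real^'n" where "x \<noteq> 0" "1 \<bullet> x = 0" "\<And>e. e \<in> U \<Longrightarrow> incidence e \<bullet> x = 0"
proof -
  let ?R = "{(i, j). {i, j} \<in> U}"
  obtain u v where uv: "(u, v) \<notin> ?R\<^sup>*"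
    using assms(1) by (auto simp: connected_links_def)
  define c where "c = real (card {i. (u, i) \<in> ?R\<^sup>*}) / real CARD('n)"
  define x :: "real^'n" where "x = (\<chi> i. of_bool ((u, i) \<in> ?R\<^sup>*) - c)"
  have "x $ u \<noteq> x $ v"
    using uv by (simp add: x_def)
  then have "x \<noteq> 0"
    by auto
  moreover have "1 \<bullet> x = 0"
    by (simp add: x_def c_def inner_vec_def sum_subtractf of_bool_def sum.If_cases)
  moreover have "incidence e \<bullet> x = 0" if e: "e \<in> U" for e
  proof -
    obtain a b where ab: "e = {a, b}" "a \<noteq> b"
      using links[OF e] by (metis card_2_iff)
    then have "(a, b) \<in> ?R" "(b, a) \<in> ?R"
      using e by (auto simp: insert_commute)
    then have "(u, a) \<in> ?R\<^sup>* \<longleftrightarrow> (u, b) \<in> ?R\<^sup>*"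
      by (meson rtrancl.rtrancl_into_rtrancl)
    then show ?thesis
      using ab by (simp add: inner_incidence x_def)
  qed
  ultimately show ?thesis
    using that by blast
qed

text \<open>Adding \<open>c\<^sup>2\<close> to every entry adds the rank-one matrix of the constant
  vector with entries \<open>c\<close>. Cauchy--Binet then applies to this vector together with the
  link vectors scaled by the roots of the weights.\<close>

theorem weighted_matrix_tree:
  fixes L :: "'n::finite set set"
  assumes G: "weighted_graph L w"
  shows "det (\<chi> i j. laplacian L w $ i $ j + c\<^sup>2) = c\<^sup>2 * (real CARD('n))\<^sup>2 * spanning_tree_weight L w"
proof -
  have links: "\<And>e. e \<in> L \<Longrightarrow> card e = 2" and w: "\<And>e. e \<in> L \<Longrightarrow> w e \<ge> 0"
    using G by (auto simp: weighted_graph_def less_imp_le)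
  \<comment> \<open>\<open>None\<close> indexes the constant vector and \<open>Some e\<close> the
    vector of the link \<open>e\<close>.\<close>
  define a where "a s = (case s of None \<Rightarrow> vec c | Some e \<Rightarrow> sqrt (w e) *\<^sub>R incidence e)" for s :: "'n set option"
  have a: "a None = vec c" "a (Some e) = sqrt (w e) *\<^sub>R incidence e" for e
    by (simp_all add: a_def)
  define lift where "lift U = insert None (Some ` U)" for U :: "'n set set"
  define links_of where "links_of T = {e. Some e \<in> T}" for T :: "'n set option set"
  \<comment> \<open>The value that the term of \<open>T\<close> will turn out to have; it is
    established together with the choice of an enumeration of \<open>T\<close>.\<close>
  define V where "V T = (if None \<in> T \<and> links_of T \<in> spanning_trees L
    then c\<^sup>2 * (real CARD('n))\<^sup>2 * (\<Prod>e\<in>links_of T. w e) else 0)" for T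
  let ?S = "lift L"
  let ?\<T> = "{T. T \<subseteq> ?S \<and> card T = CARD('n)}"
  have lift_links_of: "lift (links_of T) = T" if "None \<in> T" for T
  proof (rule set_eqI)
    fix s show "s \<in> lift (links_of T) \<longleftrightarrow> s \<in> T"
      using that by (cases s) (auto simp: lift_def links_of_def)
  qed
  have links_of_lift: "links_of (lift U) = U" for U
    by (auto simp: lift_def links_of_def)
  have card_lift: "card (lift U) = Suc (card U)" for U
    unfolding lift_def by (subst card_insert_disjoint) (auto simp: card_image)
  have tree_card: "card U = CARD('n) - 1" if "U \<in> spanning_trees L" for U
    using that links by (subst connected_acyclic_iff_card[symmetric]) (auto simp: spanning_trees_def)
  have "\<exists>f. bij_betw f UNIV T \<and> (det (\<chi> i. a (f i)))\<^sup>2 = V T" if T: "T \<in> ?\<T>" for T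
  proof (cases "None \<in> T \<and> links_of T \<in> spanning_trees L")
    case True
    then have "connected_links (links_of T)" "acyclic_links (links_of T)" "links_of T \<subseteq> L"
      by (auto simp: spanning_trees_def)
    then obtain f :: "'n \<Rightarrow> 'n set option" where "bij_betw f UNIV (insert None (Some ` links_of T))"
      "(det (\<chi> v. a (f v)))\<^sup>2 = c\<^sup>2 * (real CARD('n))\<^sup>2 * (\<Prod>e\<in>links_of T. w e)"
      using det_links_square[of "links_of T" w a c] links w a by blast
    then show ?thesis
      using True lift_links_of[of T] by (auto simp: V_def lift_def)
  next
    case False
    obtain f :: "'n \<Rightarrow> 'n set option" where f: "bij_betw f UNIV T"
      using T finite_same_card_bij[of "UNIV :: 'n set" T] by (auto intro: finite_subset)
    have fT: "f i \<in> T" for i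
      using f by (auto simp: bij_betw_def)
    have sub: "links_of T \<subseteq> L"
      using T by (auto simp: lift_def links_of_def)
    have "\<exists>x. x \<noteq> 0 \<and> (\<forall>s\<in>T. a s \<bullet> x = 0)"
    proof (cases "None \<in> T")
      case True
      then have nontree: "links_of T \<notin> spanning_trees L"
        using False by blast
      \<comment> \<open>With the number of links of a tree, \<open>links_of T\<close> can fail to be
        a spanning tree only by being disconnected.\<close>
      have "card (links_of T) = CARD('n) - 1"
        using T card_lift[of "links_of T"] lift_links_of[OF True] by simp
      then have "\<not> connected_links (links_of T)"
        using nontree sub links connected_acyclic_iff_card[of "links_of T"]
        by (auto simp: spanning_trees_def)
      then obtain x where x: "x \<noteq> 0" "1 \<bullet> x = 0" "\<And>e. e \<in> links_of T \<Longrightarrow> incidence e \<bullet> x = 0"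
        using separating_vector[of "links_of T"] sub links by blast
      have "vec c \<bullet> x = c * (1 \<bullet> x)"
        by (simp add: inner_vec_def sum_distrib_left)
      then have "a s \<bullet> x = 0" if "s \<in> T" for s
        using that x by (cases s) (auto simp: a links_of_def)
      then show ?thesis
        using x(1) by blast
    next
      \<comment> \<open>Without the constant vector only link vectors remain, and all of them are
        orthogonal to \<open>1\<close>.\<close>
      case False
      have "a s \<bullet> 1 = 0" if "s \<in> T" for s
        using that False sub links by (cases s) (auto simp: a links_of_def inner_incidence_one)
      moreover have "(1 :: real^'n) \<noteq> 0"
        by (simp add: vec_eq_iff)
      ultimately show ?thesis
        by blast
    qed
    then have "det (\<chi> i. a (f i)) = 0"
      using fT by (auto intro!: det_eq_0_if_orthogonal)
    then show ?thesis
      using f False by (auto simp: V_def)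
  qed
  then have "\<exists>g. \<forall>T\<in>?\<T>. bij_betw (g T) UNIV T \<and> (det (\<chi> i. a (g T i)))\<^sup>2 = V T"
    by (intro bchoice) blast
  then obtain g where g: "\<And>T. T \<in> ?\<T> \<Longrightarrow> bij_betw (g T) UNIV T"
    "\<And>T. T \<in> ?\<T> \<Longrightarrow> (det (\<chi> i. a (g T i)))\<^sup>2 = V T"
    by blast
  have "laplacian L w $ i $ j + c\<^sup>2 = (\<Sum>s\<in>?S. a s $ i * a s $ j)" for i j
  proof -
    have "(\<Sum>s\<in>?S. a s $ i * a s $ j) = c\<^sup>2 + (\<Sum>e\<in>L. a (Some e) $ i * a (Some e) $ j)"
      unfolding lift_def
      by (subst sum.insert) (auto simp: a power2_eq_square sum.reindex)
    also have "(\<Sum>e\<in>L. a (Some e) $ i * a (Some e) $ j) = laplacian L w $ i $ j"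
      unfolding laplacian_nth[OF G]
    proof (intro sum.cong refl)
      fix e assume "e \<in> L"
      then have "sqrt (w e) * sqrt (w e) = w e"
        using w by simp
      then show "a (Some e) $ i * a (Some e) $ j = w e * (incidence e $ i * incidence e $ j)"
        by (simp add: a mult_ac)
    qed
    finally show ?thesis
      by simp
  qed
  then have "det (\<chi> i j. laplacian L w $ i $ j + c\<^sup>2) = det (\<chi> i j. \<Sum>s\<in>?S. a s $ i * a s $ j)"
    by simp
  also have "\<dots> = (\<Sum>T\<in>?\<T>. (det (\<chi> i. a (g T i)))\<^sup>2)"
    using g(1) by (intro det_sum_rank_one) simp_all
  also have "\<dots> = (\<Sum>T\<in>?\<T>. V T)"
    using g(2) by (rule sum.cong[OF refl])
  also have "\<dots> = (\<Sum>T\<in>lift ` spanning_trees L. V T)"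
  proof (rule sum.mono_neutral_right)
    show "lift ` spanning_trees L \<subseteq> ?\<T>"
    proof (rule image_subsetI)
      fix U assume U: "U \<in> spanning_trees L"
      then have "lift U \<subseteq> lift L"
        unfolding lift_def spanning_trees_def by blast
      moreover have "card (lift U) = CARD('n)"
        using tree_card[OF U] by (simp add: card_lift)
      ultimately show "lift U \<in> ?\<T>"
        by blast
    qed
    show "\<forall>T\<in>?\<T> - lift ` spanning_trees L. V T = 0"
    proof
      fix T assume "T \<in> ?\<T> - lift ` spanning_trees L"
      then have "\<not> (None \<in> T \<and> links_of T \<in> spanning_trees L)"
        using imageI[of "links_of T" "spanning_trees L" lift] lift_links_of[of T] by auto
      then show "V T = 0"
        unfolding V_def by (rule if_not_P)
    qed
  qed simp
  also have "\<dots> = (\<Sum>U\<in>spanning_trees L. V (lift U))"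
    by (rule sum.reindex_cong[of lift]) (auto intro: inj_on_inverseI[of _ links_of] simp: links_of_lift)
  also have "\<dots> = (\<Sum>U\<in>spanning_trees L. c\<^sup>2 * (real CARD('n))\<^sup>2 * (\<Prod>e\<in>U. w e))"
    by (intro sum.cong refl) (simp add: V_def links_of_lift, simp add: lift_def)
  finally show ?thesis
    by (simp add: spanning_tree_weight_def sum_distrib_left)
qed

section \<open>The product of the positive Laplacian eigenvalues\<close>

text \<open>Adding the rank-one matrix of \<open>zN\<close> replaces the eigenvalue 0 by 1 and keeps
  the others, so the determinant becomes the product of the \<open>\<mu> k\<close>. As
  \<open>zN\<close> is a unit vector with constant entry \<open>c\<close>, \<open>c\<^sup>2\<close>
  is the reciprocal of the number of nodes, and one factor of that number survives in the
  matrix-tree theorem.\<close>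

lemma prod_eigenvalues_eq_spanning_tree_weight:
  fixes L :: "'n::finite set set" and \<mu> :: "'m::{finite,linorder} \<Rightarrow> real"
  assumes card: "CARD('n) = Suc CARD('m)"
    and G: "weighted_graph L w" and "connected_links L"
    and E: "laplacian_eigensystem L w \<mu> z zN"
  shows "(\<Prod>k\<in>UNIV. \<mu> k) = real CARD('n) * spanning_tree_weight L w"
proof -
  define A where "A = (\<chi> i j. laplacian L w $ i $ j + zN $ i * zN $ j)"
  have Q: "laplacian L w *v z k = \<mu> k *\<^sub>R z k" "laplacian L w *v zN = 0"
    and orth: "z k \<bullet> z l = (if k = l then 1 else 0)" "z k \<bullet> zN = 0" "zN \<bullet> z k = 0" "zN \<bullet> zN = 1" for k l
    using E by (auto simp: laplacian_eigensystem_def inner_commute[of zN "z k"])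
  have A: "A *v x = laplacian L w *v x + (x \<bullet> zN) *\<^sub>R zN" for x
    by (simp add: A_def vec_eq_iff matrix_vector_mult_def inner_vec_def distrib_left distrib_right sum.distrib
        sum_distrib_left sum_distrib_right mult_ac)
  \<comment> \<open>The eigenvectors are indexed by \<open>'m option\<close>, with
    \<open>None\<close> for \<open>zN\<close>; \<open>h\<close> transports this index set to the
    nodes.\<close>
  obtain h :: "'n \<Rightarrow> 'm option" where h: "bij h"
    using finite_same_card_bij[of "UNIV :: 'n set" "UNIV :: 'm option set"] card
    by (auto simp: card_UNIV_option)
  define l where "l s = (case s of None \<Rightarrow> 1 | Some k \<Rightarrow> \<mu> k)" for s
  define y where "y s = (case s of None \<Rightarrow> zN | Some k \<Rightarrow> z k)" for s
  have "A *v y s = l s *\<^sub>R y s" for s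
    by (cases s) (simp_all add: A Q orth y_def l_def)
  moreover have "y s \<bullet> y t = (if s = t then 1 else 0)" for s t
    by (cases s; cases t) (simp_all add: orth y_def)
  ultimately have "det A = (\<Prod>i\<in>UNIV. l (h i))"
    using inj_eq[OF bij_is_inj[OF h]] by (intro det_eq_prod_eigenvalues[of _ "\<lambda>i. y (h i)"]) simp_all
  also have "\<dots> = (\<Prod>s\<in>UNIV. l s)"
    using h by (rule prod.reindex_bij_betw)
  also have "\<dots> = (\<Prod>k\<in>UNIV. \<mu> k)"
    by (simp add: UNIV_option_conv prod.reindex l_def)
  finally have det_A: "det A = (\<Prod>k\<in>UNIV. \<mu> k)" .
  \<comment> \<open>An arbitrary node at which the constant entry of \<open>zN\<close> is read
    off.\<close>
  fix i :: 'n
  define c where "c = zN $ i"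
  have zN: "zN $ j = c" for j
    unfolding c_def by (rule laplacian_kernel[OF assms(2,3) Q(2)])
  have "real CARD('n) * c\<^sup>2 = 1"
    using orth(4) by (simp add: inner_vec_def zN power2_eq_square)
  moreover have "det A = c\<^sup>2 * (real CARD('n))\<^sup>2 * spanning_tree_weight L w"
    using weighted_matrix_tree[OF G, of c] by (simp add: A_def zN power2_eq_square)
  ultimately have "det A = real CARD('n) * spanning_tree_weight L w"
    by (simp add: power2_eq_square mult_ac)
  then show ?thesis
    using det_A by simp
qed

section \<open>The volume of the ellipsoid\<close>

text \<open>Orthonormality makes the matrix diagonal, so its quadratic form at \<open>p\<close> is
  the squared norm of the vector with coordinates \<open>p $ k / sqrt (\<mu> k)\<close>; undoing
  this rescaling maps the ball onto the region.\<close>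

lemma steiner_region_eq_stretched_ball:
  fixes \<mu> :: "'m::finite \<Rightarrow> real" and z :: "'m \<Rightarrow> real^'n::finite"
  assumes pos: "\<And>k. \<mu> k > 0" and orth: "\<And>k l. z k \<bullet> z l = (if k = l then 1 else 0)"
  shows "steiner_region \<mu> z =
    (\<lambda>x. \<chi> k. sqrt (\<mu> k) * x $ k) ` cball 0 (sqrt ((real CARD('n) - 1) / real CARD('n)))"
proof -
  let ?\<rho> = "(real CARD('n) - 1) / real CARD('n)"
  have form: "p \<bullet> ((S_dagger \<mu> z ** transpose (S_dagger \<mu> z)) *v p) = (norm (\<chi> k. p $ k / sqrt (\<mu> k)))\<^sup>2" for p
  proof -
    have "(S_dagger \<mu> z ** transpose (S_dagger \<mu> z)) $ k $ l = (if k = l then 1 / \<mu> k else 0)" for k l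
    proof -
      have "(S_dagger \<mu> z ** transpose (S_dagger \<mu> z)) $ k $ l = (z k \<bullet> z l) / (sqrt (\<mu> k) * sqrt (\<mu> l))"
        by (simp add: matrix_matrix_mult_def transpose_def S_dagger_def inner_vec_def sum_divide_distrib)
      then show ?thesis
        using pos[of l] by (simp add: orth)
    qed
    then have "((S_dagger \<mu> z ** transpose (S_dagger \<mu> z)) *v p) $ k = p $ k / \<mu> k" for k
      by (simp add: matrix_vector_mult_def if_distrib[of "\<lambda>x. x * _"] sum.delta cong: if_cong)
    then show ?thesis
      using pos by (simp add: inner_vec_def power2_norm_eq_inner less_imp_le flip: real_sqrt_mult)
  qed
  have norm_le: "norm x \<le> sqrt ?\<rho> \<longleftrightarrow> (norm x)\<^sup>2 \<le> ?\<rho>" for x :: "real^'m"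
    by (metis norm_ge_zero real_le_lsqrt real_le_rsqrt real_sqrt_le_iff real_sqrt_unique)
  show ?thesis
  proof (intro equalityI subsetI)
    fix p assume "p \<in> steiner_region \<mu> z"
    then have "(\<chi> k. p $ k / sqrt (\<mu> k)) \<in> cball 0 (sqrt ?\<rho>)"
      by (simp add: steiner_region_def form norm_le)
    moreover have "p = (\<chi> k. sqrt (\<mu> k) * (\<chi> k. p $ k / sqrt (\<mu> k)) $ k)"
      using less_imp_neq[OF pos] by (simp add: vec_eq_iff)
    ultimately show "p \<in> (\<lambda>x. \<chi> k. sqrt (\<mu> k) * x $ k) ` cball 0 (sqrt ?\<rho>)"
      by (rule rev_image_eqI)
  next
    fix p assume "p \<in> (\<lambda>x. \<chi> k. sqrt (\<mu> k) * x $ k) ` cball 0 (sqrt ?\<rho>)"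
    then obtain x where x: "norm x \<le> sqrt ?\<rho>" "p = (\<chi> k. sqrt (\<mu> k) * x $ k)"
      by auto
    have "(\<chi> k. p $ k / sqrt (\<mu> k)) = x"
      using less_imp_neq[OF pos] by (simp add: x(2) vec_eq_iff)
    then show "p \<in> steiner_region \<mu> z"
      using x(1) by (simp add: steiner_region_def form norm_le)
  qed
qed

theorem mainTheorem6:
  fixes N :: nat
    and L :: "'n::finite set set" and w :: "'n set \<Rightarrow> real"
    and \<mu> :: "'m::{finite,linorder} \<Rightarrow> real" and z :: "'m \<Rightarrow> real^'n" and zN :: "real^'n"
  assumes "N \<ge> 2" and "CARD('n) = N" and "CARD('m) = N - 1"
    and "weighted_graph L w" and "connected_links L"
    and "laplacian_eigensystem L w \<mu> z zN"
  shows "measure lebesgue (steiner_region \<mu> z) =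
           ((real N - 1) * pi / real N) powr ((real N - 1) / 2) *
           (sqrt (real N * spanning_tree_weight L w) / Gamma (real N / 2 + 1 / 2))"
proof -
  let ?\<rho> = "(real N - 1) / real N"
  have pos: "\<mu> k > 0" and orth: "z k \<bullet> z l = (if k = l then 1 else 0)" for k l
    using assms(6) by (auto simp: laplacian_eigensystem_def)
  have m: "real CARD('m) = real N - 1"
    using assms(1,3) by simp
  have "CARD('n) = Suc CARD('m)"
    using assms(1-3) by simp
  then have "(\<Prod>k\<in>UNIV. \<mu> k) = real N * spanning_tree_weight L w"
    using prod_eigenvalues_eq_spanning_tree_weight[OF _ assms(4-6)] assms(2) by simp
  \<comment> \<open>The absolute value is the form in which \<open>measure_stretch\<close> supplies
    the determinant of the stretching.\<close>
  moreover have "\<bar>\<Prod>k\<in>UNIV. sqrt (\<mu> k)\<bar> = sqrt (\<Prod>k\<in>UNIV. \<mu> k)"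
    using pos by (intro real_sqrt_unique[symmetric]) (simp_all add: prod_power_distrib less_imp_le)
  ultimately have scale: "\<bar>\<Prod>k\<in>UNIV. sqrt (\<mu> k)\<bar> = sqrt (real N * spanning_tree_weight L w)"
    by simp
  have "measure lebesgue (steiner_region \<mu> z) =
    sqrt (real N * spanning_tree_weight L w) * measure lebesgue (cball (0 :: (real, 'm) vec) (sqrt ?\<rho>))"
    using steiner_region_eq_stretched_ball[OF pos orth] assms(2)
    by (simp add: measure_stretch scale)
  also have "measure lebesgue (cball (0 :: (real, 'm) vec) (sqrt ?\<rho>)) =
    unit_ball_vol (real N - 1) * sqrt ?\<rho> ^ CARD('m)"
    using assms(1) by (simp add: content_cball m)
  also have "sqrt ?\<rho> ^ CARD('m) = ?\<rho> powr ((real N - 1) / 2)"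
    using assms(1) by (simp add: powr_half_sqrt[symmetric] powr_powr m flip: powr_realpow)
  \<comment> \<open>For dimension \<open>d\<close> the Gamma function is taken at
    \<open>d / 2 + 1\<close>, which is \<open>N / 2 + 1 / 2\<close> when
    \<open>d = N - 1\<close>.\<close>
  also have "unit_ball_vol (real N - 1) = pi powr ((real N - 1) / 2) / Gamma (real N / 2 + 1 / 2)"
    by (simp add: unit_ball_vol_def diff_divide_distrib add.commute)
  also have "sqrt (real N * spanning_tree_weight L w) *
      (pi powr ((real N - 1) / 2) / Gamma (real N / 2 + 1 / 2) * ?\<rho> powr ((real N - 1) / 2)) =
    (?\<rho> * pi) powr ((real N - 1) / 2) *
      (sqrt (real N * spanning_tree_weight L w) / Gamma (real N / 2 + 1 / 2))"
    using assms(1) by (subst powr_mult) simp_all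
  finally show ?thesis
    by simp
qed

end
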